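(* Let $\Omega,\Lambda\subset\{1,\dots,N\}$ with $|\Omega|=n$ and $|\Lambda|=s$, let $0<\epsilon<1$ and $0<\delta<1$. Let $b\in\mathbb{R}^N$ and $c\in\mathbb{R}^{2N-1}$ be random vectors with independent Bernoulli $\pm1$ entries, and let $A$ denote either $\frac1{\sqrt n}S^b_\Omega$ or $\frac1{\sqrt n}T^c_\Omega$. Assume $$ n\ge \tilde C\,\delta^{-2}s\log^2(4s/\epsilon),\qquad \tilde C=4\pi^2.$$ Then with probability at least $1-\epsilon$ the minimal and maximal eigenvalues $\lambda_{\min},\lambda_{\max}$ of $A_\Lambda^*A_\Lambda$ satisfy $$1-\delta\le\lambda_{\min}\le\lambda_{\max}\le 1+\delta.$$
   Context: For $b=(b_0,\dots,b_{N-1})\in\mathbb{R}^N$ the circulant matrix $S^b\in\mathbb{R}^{N\times N}$ has entries $S^b_{i,j}=b_{(j-i)\bmod N}$, $i,j=1,\dots,N$. For $c=(c_{-N+1},\dots,c_{N-1})\in\mathbb{R}^{2N-1}$ the Toeplitz matrix $T^c\in\mathbb{R}^{N\times N}$ has entries $T^c_{i,j}=c_{j-i}$. $S^b_\Omega$ (resp. $T^c_\Omega$) is the submatrix consisting of the rows indexed by $\Omega$. A Bernoulli $\pm1$ variable takes values $\pm1$ with probability $1/2$ each. $A_\Lambda$ denotes the submatrix of $A$ consisting of the columns indexed by $\Lambda$. *)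

theory Defs
  imports "HOL-Probability.Probability" "Jordan_Normal_Form.Char_Poly"
begin

text \<open>Row/column indices run over 1..N as in the paper. The submatrix with rows
  indexed by Omega (resp. columns by Lambda) lists them in increasing order.\<close>

definition circulant_entry :: "nat \<Rightarrow> (nat \<Rightarrow> real) \<Rightarrow> nat \<Rightarrow> nat \<Rightarrow> real" where
  "circulant_entry N b i j = b (nat ((int j - int i) mod int N))"

definition toeplitz_entry :: "(int \<Rightarrow> real) \<Rightarrow> nat \<Rightarrow> nat \<Rightarrow> real" where
  "toeplitz_entry c i j = c (int j - int i)"

definition sub_matrix_scaled :: "(nat \<Rightarrow> nat \<Rightarrow> real) \<Rightarrow> nat set \<Rightarrow> nat set \<Rightarrow> real mat" where
  "sub_matrix_scaled M Om La =
     mat (card Om) (card La)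
       (\<lambda>(r, k). (1 / sqrt (real (card Om))) *
                  M (sorted_list_of_set Om ! r) (sorted_list_of_set La ! k))"

definition gram :: "real mat \<Rightarrow> real mat" where
  "gram B = transpose_mat B * B"

text \<open>All eigenvalues of the (symmetric) matrix lie in [1-delta,1+delta], i.e.
  1-delta <= lambda_min <= lambda_max <= 1+delta.\<close>
definition eig_in_range :: "real mat \<Rightarrow> real \<Rightarrow> bool" where
  "eig_in_range G \<delta> \<longleftrightarrow> (\<forall>ev. eigenvalue G ev \<longrightarrow> 1 - \<delta> \<le> ev \<and> ev \<le> 1 + \<delta>)"

definition bern_b :: "nat \<Rightarrow> (nat \<Rightarrow> real) pmf" where
  "bern_b N = pmf_of_set (PiE {0..<N} (\<lambda>_. {-1, 1}))"

definition bern_c :: "nat \<Rightarrow> (int \<Rightarrow> real) pmf" where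
  "bern_c N = pmf_of_set (PiE {-(int N - 1)..int N - 1} (\<lambda>_. {-1, 1}))"

end

theory Submission
  imports Defs
begin

text \<open>Off the diagonal, \<open>n\<close> times the Gram matrix is \<open>H k l = (\<Sum>i\<in>\<Omega>. b (\<phi> k i) * b (\<phi> l i))\<close>, where the
  index map \<open>\<phi>\<close> (\<open>k - i\<close>, taken modulo \<open>N\<close> in the circulant case) is injective in each argument.
  The expected trace of \<open>H ^ (2 * m)\<close> counts the closed walks \<open>k, i, k', i', \<dots>\<close> along which every
  index is met an even number of times. Build such a walk step by step, choosing \<open>i\<close> and then \<open>k'\<close>
  from \<open>k\<close>: if neither new index closes an open one there are at most \<open>n * s\<close> choices; if exactly
  one does, injectivity leaves at most \<open>s\<close> choices once the closed index is known; if both do, the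
  step is determined. Since \<open>s \<le> n\<close>, giving each opening the weight \<open>w = sqrt (n * s)\<close> dominates the
  count by \<open>s * w ^ (2 * m)\<close> times the number of perfect matchings of \<open>4 * m\<close> points, which is at most
  \<open>(2 * m) ^ (2 * m)\<close>. Markov's inequality with \<open>m = \<lfloor>ln (4 * s / \<epsilon>)\<rfloor>\<close> concludes.\<close>

section \<open>Powers of kernels on a finite index set\<close>

primrec kernel_power :: "'k set \<Rightarrow> ('k \<Rightarrow> 'k \<Rightarrow> real) \<Rightarrow> nat \<Rightarrow> 'k \<Rightarrow> 'k \<Rightarrow> real" where
  "kernel_power K H 0 k l = (if k = l then 1 else 0)"
| "kernel_power K H (Suc r) k l = (\<Sum>x\<in>K. H k x * kernel_power K H r x l)"

lemma kernel_power_add: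
  assumes "finite K" "k \<in> K"
  shows "kernel_power K H (a + b) k l = (\<Sum>x\<in>K. kernel_power K H a k x * kernel_power K H b x l)"
  using assms(2)
proof (induction a arbitrary: k)
  case 0
  have "(\<Sum>x\<in>K. (if k = x then 1 else 0) * kernel_power K H b x l)
      = (\<Sum>x\<in>K. if k = x then kernel_power K H b x l else 0)"
    by (intro sum.cong) auto
  then show ?case using 0 assms(1) by (simp add: sum.delta')
next
  case (Suc a)
  have "kernel_power K H (Suc a + b) k l
      = (\<Sum>y\<in>K. H k y * (\<Sum>x\<in>K. kernel_power K H a y x * kernel_power K H b x l))"
    using Suc.IH by simp
  also have "\<dots> = (\<Sum>x\<in>K. \<Sum>y\<in>K. H k y * kernel_power K H a y x * kernel_power K H b x l)"
    unfolding sum_distrib_left by (subst sum.swap) (simp add: mult.assoc)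
  finally show ?case by (simp add: sum_distrib_right)
qed

lemma kernel_power_commute:
  assumes "finite K" "\<And>x y. H x y = H y x" "k \<in> K" "l \<in> K"
  shows "kernel_power K H r k l = kernel_power K H r l k"
  using assms(3,4)
proof (induction r arbitrary: k l)
  case 0
  then show ?case by auto
next
  case (Suc r)
  have one: "kernel_power K H 1 x k = H x k" for x
    using assms(1) \<open>k \<in> K\<close> by (simp add: if_distrib [of "(*) _"] cong: if_cong)
  have "kernel_power K H (Suc r) k l = (\<Sum>x\<in>K. kernel_power K H r l x * H x k)"
    using Suc assms(2) by (auto intro!: sum.cong simp: mult.commute)
  also have "\<dots> = (\<Sum>x\<in>K. kernel_power K H r l x * kernel_power K H 1 x k)"
    by (simp only: one)
  also have "\<dots> = kernel_power K H (r + 1) l k"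
    using kernel_power_add [OF assms(1) \<open>l \<in> K\<close>, of H r 1 k] by simp
  finally show ?case by simp
qed

lemma kernel_power_eigenvector:
  assumes "finite K" "\<And>k. k \<in> K \<Longrightarrow> (\<Sum>l\<in>K. H k l * v l) = \<mu> * v k" "k \<in> K"
  shows "(\<Sum>l\<in>K. kernel_power K H r k l * v l) = \<mu> ^ r * v k"
  using assms(3)
proof (induction r arbitrary: k)
  case 0
  have "(\<Sum>l\<in>K. (if k = l then 1 else 0) * v l) = (\<Sum>l\<in>K. if k = l then v l else 0)"
    by (intro sum.cong) auto
  then show ?case using 0 assms(1) by (simp add: sum.delta')
next
  case (Suc r)
  have "(\<Sum>l\<in>K. kernel_power K H (Suc r) k l * v l)
      = (\<Sum>x\<in>K. H k x * (\<Sum>l\<in>K. kernel_power K H r x l * v l))"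
    unfolding kernel_power.simps sum_distrib_left sum_distrib_right
    by (subst sum.swap) (simp add: mult.assoc)
  also have "\<dots> = (\<Sum>x\<in>K. \<mu> ^ r * (H k x * v x))"
    using Suc.IH by (intro sum.cong) auto
  also have "\<dots> = \<mu> ^ r * (\<mu> * v k)"
    unfolding sum_distrib_left [symmetric] using assms(2) Suc.prems by simp
  finally show ?case by simp
qed

text \<open>By symmetry the trace of \<open>H ^ (2 * m)\<close> is the sum of the squared entries of
  \<open>H ^ m\<close>. Since \<open>H ^ m\<close> maps \<open>v\<close> to \<open>\<mu> ^ m\<close>
  times \<open>v\<close>, Cauchy-Schwarz in each row gives the bound without diagonalising
  \<open>H\<close>.\<close>

lemma eigenvalue_power_le_trace:
  assumes "finite K" "\<And>x y. H x y = H y x"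
    and "\<And>k. k \<in> K \<Longrightarrow> (\<Sum>l\<in>K. H k l * v l) = \<mu> * v k"
    and "k0 \<in> K" "v k0 \<noteq> 0"
  shows "\<mu> ^ (2 * m) \<le> (\<Sum>k\<in>K. kernel_power K H (2 * m) k k)"
proof -
  define V where "V = (\<Sum>l\<in>K. (v l)\<^sup>2)"
  have "(v k0)\<^sup>2 \<le> V"
    unfolding V_def by (rule member_le_sum) (use assms in auto)
  with assms(5) have V: "V > 0"
    by (meson less_le_trans zero_less_power2)
  have "\<mu> ^ (2 * m) * V = (\<Sum>k\<in>K. (\<mu> ^ m * v k)\<^sup>2)"
    by (simp add: V_def sum_distrib_left power_mult_distrib power_mult power_commutes
        flip: power_mult)
      (simp add: mult.commute)
  also have "\<dots> = (\<Sum>k\<in>K. (\<Sum>l\<in>K. kernel_power K H m k l * v l)\<^sup>2)"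
    using kernel_power_eigenvector [where H = H and v = v, OF assms(1,3)] by simp
  also have "\<dots> \<le> (\<Sum>k\<in>K. (\<Sum>l\<in>K. (kernel_power K H m k l)\<^sup>2) * V)"
    unfolding V_def by (intro sum_mono Cauchy_Schwarz_ineq_sum)
  also have "\<dots> = (\<Sum>k\<in>K. \<Sum>l\<in>K. kernel_power K H m k l * kernel_power K H m l k) * V"
    unfolding sum_distrib_right [symmetric] power2_eq_square
    using kernel_power_commute [where H = H, OF assms(1,2)]
    by (auto intro!: sum.cong)
  also have "\<dots> = (\<Sum>k\<in>K. kernel_power K H (2 * m) k k) * V"
    using kernel_power_add [OF assms(1), of _ H m m] by (simp add: mult_2)
  finally show ?thesis
    using V by simp
qed

section \<open>Weighted matchings\<close>

text \<open>The weighted number of ways of reading \<open>j\<close> further points, starting with \<open>u\<close> points that are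
  still unmatched, so that all points end up matched in pairs: a new point either stays open for
  later (weight \<open>w\<close>) or closes one of the open points.\<close>

fun matching_weight :: "real \<Rightarrow> nat \<Rightarrow> nat \<Rightarrow> real" where
  "matching_weight w 0 u = (if u = 0 then 1 else 0)"
| "matching_weight w (Suc j) u =
     w * matching_weight w j (u + 1) + real u * matching_weight w j (u - 1)"

lemma matching_weight_nonneg: "w \<ge> 0 \<Longrightarrow> matching_weight w j u \<ge> 0"
  by (induction j arbitrary: u) auto

lemma matching_weight_eq_0: "j < u \<Longrightarrow> matching_weight w j u = 0"
  by (induction j arbitrary: u) auto

text \<open>Of the \<open>j\<close> points to come, \<open>u\<close> close the open ones and the
  other \<open>2 * h\<close> are matched among themselves: \<open>fact j / fact (2 * h)\<close>
  choices times \<open>fact (2 * h) / (2 ^ h * fact h)\<close>, each with \<open>h\<close> openings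
  of weight \<open>w\<close>.\<close>

lemma matching_weight_eq:
  "j = u + 2 * h \<Longrightarrow> matching_weight w j u * (2 ^ h * fact h) = w ^ h * fact j"
proof (induction j arbitrary: u h)
  case 0
  then show ?case by simp
next
  case (Suc j)
  \<comment> \<open>Of the total factor \<open>Suc j = 2 * h + u\<close>, opening supplies
    \<open>2 * h\<close> and closing supplies \<open>u\<close>. For \<open>h = 0\<close> too few
    points remain to close another opening, so the first share vanishes.\<close>
  have open_part: "w * matching_weight w j (u + 1) * (2 ^ h * fact h) = 2 * real h * (w ^ h * fact j)"
  proof (cases h)
    case 0
    then show ?thesis using Suc.prems by (simp add: matching_weight_eq_0)
  next
    case (Suc h')
    have "matching_weight w j (u + 1) * (2 ^ h' * fact h') = w ^ h' * fact j"
      using Suc Suc.IH [of "u + 1" h'] \<open>Suc j = u + 2 * h\<close> by simp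
    then have "w * (2 * real h) * (matching_weight w j (u + 1) * (2 ^ h' * fact h'))
        = w * (2 * real h) * (w ^ h' * fact j)" by simp
    then show ?thesis using Suc by (simp add: algebra_simps)
  qed
  have close_part: "real u * matching_weight w j (u - 1) * (2 ^ h * fact h) = real u * (w ^ h * fact j)"
  proof (cases u)
    case 0
    then show ?thesis by simp
  next
    case (Suc u')
    then show ?thesis
      using Suc.IH [of "u - 1" h] \<open>Suc j = u + 2 * h\<close> by simp
  qed
  have "matching_weight w (Suc j) u * (2 ^ h * fact h)
      = w * matching_weight w j (u + 1) * (2 ^ h * fact h)
        + real u * matching_weight w j (u - 1) * (2 ^ h * fact h)"
    by (simp add: algebra_simps)
  also have "\<dots> = (2 * real h + real u) * (w ^ h * fact j)"
    unfolding open_part close_part by (simp add: algebra_simps)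
  also have "2 * real h + real u = real (Suc j)"
    using Suc.prems by simp
  finally show ?case by simp
qed

text \<open>The quotient \<open>fact (2 * h) / (2 ^ h * fact h)\<close> counts the perfect matchings
  of \<open>2 * h\<close> points. Passing to \<open>Suc h\<close> multiplies it by
  \<open>2 * h + 1\<close>, which Bernoulli's inequality for \<open>(1 + 1 / h) ^ h\<close>
  covers.\<close>

lemma fact_double_le: "(fact (2 * h) :: real) \<le> 2 ^ h * fact h * real h ^ h"
proof (induction h)
  case 0
  then show ?case by simp
next
  case (Suc h)
  have bern: "2 * real h ^ h \<le> real (Suc h) ^ h" if "h > 0"
  proof -
    have "1 + real h * (1 / real h) \<le> (1 + 1 / real h) ^ h"
      by (rule Bernoulli_inequality) (rule order_trans [of _ 0], auto)
    then have "2 * real h ^ h \<le> (1 + 1 / real h) ^ h * real h ^ h"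
      using that by (intro mult_right_mono) auto
    also have "\<dots> = real (Suc h) ^ h"
      using that by (simp add: field_simps flip: power_mult_distrib)
    finally show ?thesis .
  qed
  have "(2 * real h + 1) * real h ^ h \<le> real (Suc h) ^ Suc h"
  proof (cases "h = 0")
    case False
    have "(2 * real h + 1) * real h ^ h \<le> real (Suc h) * (2 * real h ^ h)"
      by (simp add: algebra_simps)
    also have "\<dots> \<le> real (Suc h) * real (Suc h) ^ h"
      using bern False by (intro mult_left_mono) auto
    finally show ?thesis by simp
  qed simp
  then have "2 * real (Suc h) * (2 ^ h * fact h) * ((2 * real h + 1) * real h ^ h)
      \<le> 2 * real (Suc h) * (2 ^ h * fact h) * real (Suc h) ^ Suc h"
    by (intro mult_left_mono) auto
  moreover have "(fact (2 * Suc h) :: real) = 2 * real (Suc h) * (2 * real h + 1) * fact (2 * h)"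
    by (simp add: algebra_simps)
  moreover have "\<dots> \<le> 2 * real (Suc h) * (2 * real h + 1) * (2 ^ h * fact h * real h ^ h)"
    by (intro mult_left_mono Suc.IH) auto
  ultimately show ?case
    by (simp add: algebra_simps)
qed

lemma matching_weight_le:
  assumes "w \<ge> 0"
  shows "matching_weight w (2 * h) 0 \<le> (w * real h) ^ h"
proof -
  have "matching_weight w (2 * h) 0 * (2 ^ h * fact h) = w ^ h * fact (2 * h)"
    by (rule matching_weight_eq) simp
  also have "\<dots> \<le> w ^ h * (2 ^ h * fact h * real h ^ h)"
    using assms by (intro mult_left_mono fact_double_le) auto
  finally have "matching_weight w (2 * h) 0 * (2 ^ h * fact h) \<le> (w * real h) ^ h * (2 ^ h * fact h)"
    by (simp add: power_mult_distrib algebra_simps)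
  then show ?thesis
    by (rule mult_right_le_imp_le) simp
qed

section \<open>Trace moments of a sign chaos\<close>

abbreviation signs :: "'a set \<Rightarrow> ('a \<Rightarrow> real) set" where
  "signs D \<equiv> PiE D (\<lambda>_. {-1, 1})"

lemma sum_signs_prod:
  assumes "finite D" "U \<subseteq> D"
  shows "(\<Sum>b\<in>signs D. \<Prod>x\<in>U. b x) = (if U = {} then real (card (signs D)) else 0)"
proof (cases "U = {}")
  case False
  have "(\<Sum>b\<in>signs D. \<Prod>x\<in>U. b x) = (\<Sum>b\<in>signs D. \<Prod>x\<in>D. if x \<in> U then b x else 1)"
    using assms by (intro sum.cong refl) (auto simp: prod.If_cases Int_absorb1)
  also have "\<dots> = (\<Prod>x\<in>D. \<Sum>y\<in>{-1, 1}. if x \<in> U then y else 1)"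
    using assms(1) by (subst prod_sum_PiE) auto
  also have "\<dots> = 0"
    using False assms by (intro prod_zero) auto
  finally show ?thesis using False by simp
qed simp

text \<open>Symmetric difference with \<open>{p}\<close>: the update of the set of values of odd
  multiplicity when \<open>p\<close> is met once more.\<close>

definition toggle :: "'a \<Rightarrow> 'a set \<Rightarrow> 'a set" where
  "toggle p U = (if p \<in> U then U - {p} else insert p U)"

lemma toggle_subset: "p \<in> D \<Longrightarrow> U \<subseteq> D \<Longrightarrow> toggle p U \<subseteq> D"
  by (auto simp: toggle_def)

text \<open>Signs square to \<open>1\<close>, so a repeated factor cancels and only parities of
  multiplicities matter.\<close>

lemma sign_mult_prod:
  assumes "b \<in> signs D" "p \<in> D" "finite U"
  shows "(\<Prod>x\<in>U. b x) * b p = (\<Prod>x\<in>toggle p U. b x)"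
proof (cases "p \<in> U")
  case True
  have "b p = -1 \<or> b p = 1" using assms by (auto simp: PiE_iff)
  moreover have "(\<Prod>x\<in>U. b x) = b p * (\<Prod>x\<in>U - {p}. b x)"
    using assms True by (simp add: prod.remove)
  ultimately show ?thesis using True by (auto simp: toggle_def)
qed (use assms in \<open>simp add: toggle_def mult.commute\<close>)

lemma card_toggle_toggle:
  assumes "finite U" "p \<noteq> q"
  shows "card (toggle q (toggle p U)) =
    (if p \<in> U then if q \<in> U then card U - 2 else card U
     else if q \<in> U then card U else card U + 2)"
proof -
  have "card U > 0" if "x \<in> U" for x
    using that assms(1) card_gt_0_iff by blast
  then show ?thesis
    using assms by (auto simp: toggle_def card_Diff_subset card_insert_if)
qed

text \<open>What the circulant and Toeplitz cases share: an array in which no value repeats along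
  either coordinate direction. The first argument of \<open>\<phi>\<close> is a column of the random
  matrix, the second a row.\<close>

locale latin_array =
  fixes \<phi> :: "'k \<Rightarrow> 'i \<Rightarrow> 'a" and K :: "'k set" and I :: "'i set" and D :: "'a set"
  assumes finite_K: "finite K" and finite_I: "finite I" and finite_D: "finite D"
    and range: "k \<in> K \<Longrightarrow> i \<in> I \<Longrightarrow> \<phi> k i \<in> D"
    and inj_row: "k \<in> K \<Longrightarrow> inj_on (\<phi> k) I"
    and inj_col: "i \<in> I \<Longrightarrow> inj_on (\<lambda>k. \<phi> k i) K"
begin

text \<open>For signs \<open>b\<close> all diagonal entries of the unnormalised Gram matrix equal
  \<open>card I\<close>, so this is that matrix minus \<open>card I\<close> times the
  identity.\<close>

definition offdiag :: "('a \<Rightarrow> real) \<Rightarrow> 'k \<Rightarrow> 'k \<Rightarrow> real" where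
  "offdiag b k l = (if k = l then 0 else \<Sum>i\<in>I. b (\<phi> k i) * b (\<phi> l i))"

lemma offdiag_commute: "offdiag b k l = offdiag b l k"
  by (simp add: offdiag_def mult.commute)

text \<open>Let \<open>A\<close> indicate that a value is open. For each \<open>l\<close>,
  injectivity in \<open>i\<close> allows at most \<open>card U\<close> indices \<open>i\<close> with
  \<open>A l i = 1\<close>; once \<open>\<phi> k i\<close> is open, injectivity in \<open>l\<close>
  leaves at most \<open>card U - 1\<close> indices \<open>l \<noteq> k\<close>.\<close>

lemma sum_over_steps_le:
  fixes g :: "nat \<Rightarrow> real"
  assumes k: "k \<in> K" and U: "finite U" and g: "\<And>u. g u \<ge> 0"
  shows "(\<Sum>l\<in>K - {k}. \<Sum>i\<in>I. g (card (toggle (\<phi> l i) (toggle (\<phi> k i) U))))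
    \<le> real (card K) * real (card I) * g (card U + 2)
      + 2 * real (card K) * real (card U) * g (card U)
      + real (card U) * real (card U - 1) * g (card U - 2)"
proof -
  define u where "u = card U"
  define A where "A l i = (of_bool (\<phi> l i \<in> U) :: real)" for l i
  have cK: "card (K - {k}) \<le> card K"
    using finite_K by (simp add: card_Diff1_le)
  have sum_A: "(\<Sum>i\<in>I. A l i) \<le> real u" if "l \<in> K" for l
  proof -
    have "card {i \<in> I. \<phi> l i \<in> U} \<le> card U"
      by (rule card_inj_on_le [where f = "\<phi> l"])
        (use inj_row [OF that] U in \<open>auto intro: inj_on_subset\<close>)
    then show ?thesis
      using finite_I by (simp add: A_def u_def Int_def)
  qed
  have sum_AA: "(\<Sum>l\<in>K - {k}. A k i * A l i) \<le> A k i * real (u - 1)" if i: "i \<in> I" for i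
  proof (cases "\<phi> k i \<in> U")
    case True
    have "card {l \<in> K - {k}. \<phi> l i \<in> U} \<le> card (U - {\<phi> k i})"
      by (rule card_inj_on_le [where f = "\<lambda>l. \<phi> l i"])
        (use inj_col [OF i] U k in \<open>auto intro: inj_on_subset dest: inj_onD\<close>)
    then have "(\<Sum>l\<in>K - {k}. A l i) \<le> real (u - 1)"
      using finite_K True U by (simp add: A_def u_def Int_def)
    then show ?thesis using True by (simp add: A_def)
  qed (simp add: A_def)
  have step: "g (card (toggle (\<phi> l i) (toggle (\<phi> k i) U)))
      \<le> g (u + 2) + (A k i + A l i) * g u + A k i * A l i * g (u - 2)"
    if "l \<in> K - {k}" "i \<in> I" for l i
  proof -
    have "\<phi> k i \<noteq> \<phi> l i" using that k inj_col by (auto dest: inj_onD)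
    then show ?thesis
      using g [of "u + 2"] g [of u] g [of "u - 2"] U
      by (auto simp: card_toggle_toggle A_def u_def)
  qed
  have "(\<Sum>l\<in>K - {k}. \<Sum>i\<in>I. g (card (toggle (\<phi> l i) (toggle (\<phi> k i) U))))
      \<le> (\<Sum>l\<in>K - {k}. \<Sum>i\<in>I. g (u + 2) + (A k i + A l i) * g u + A k i * A l i * g (u - 2))"
    by (intro sum_mono step) auto
  also have "\<dots> = real (card (K - {k})) * real (card I) * g (u + 2)
      + (\<Sum>l\<in>K - {k}. (\<Sum>i\<in>I. A k i) + (\<Sum>i\<in>I. A l i)) * g u
      + (\<Sum>i\<in>I. \<Sum>l\<in>K - {k}. A k i * A l i) * g (u - 2)"
    unfolding sum.swap [of "\<lambda>i l. A k i * A l i" "K - {k}" I]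
    by (simp add: sum.distrib sum_distrib_right [symmetric])
  also have "\<dots> \<le> real (card K) * real (card I) * g (u + 2)
      + (2 * real (card K) * real u) * g u + (real u * real (u - 1)) * g (u - 2)"
  proof (intro add_mono mult_right_mono g)
    have "(\<Sum>l\<in>K - {k}. (\<Sum>i\<in>I. A k i) + (\<Sum>i\<in>I. A l i)) \<le> (\<Sum>l\<in>K - {k}. real u + real u)"
      using k by (intro sum_mono add_mono sum_A) auto
    also have "\<dots> = real (card (K - {k})) * (2 * real u)" by simp
    also have "\<dots> \<le> real (card K) * (2 * real u)"
      using cK by (intro mult_right_mono) auto
    finally show "(\<Sum>l\<in>K - {k}. (\<Sum>i\<in>I. A k i) + (\<Sum>i\<in>I. A l i)) \<le> 2 * real (card K) * real u"
      by simp
    have "(\<Sum>i\<in>I. \<Sum>l\<in>K - {k}. A k i * A l i) \<le> (\<Sum>i\<in>I. A k i * real (u - 1))"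
      by (intro sum_mono sum_AA)
    also have "\<dots> \<le> real u * real (u - 1)"
      unfolding sum_distrib_right [symmetric] using sum_A [OF k] by (intro mult_right_mono) auto
    finally show "(\<Sum>i\<in>I. \<Sum>l\<in>K - {k}. A k i * A l i) \<le> real u * real (u - 1)" .
  qed (use cK in auto)
  finally show ?thesis by (simp add: u_def)
qed

text \<open>The set \<open>U\<close> records the values that have occurred an odd number of times along the initial
  part of a closed walk; it plays the role of the open points of a matching.\<close>

lemma chaos_moment_le:
  assumes w: "w \<ge> 0" "w\<^sup>2 = real (card K) * real (card I)" "real (card K) \<le> w"
    and "k \<in> K" "U \<subseteq> D"
  shows "(\<Sum>b\<in>signs D. (\<Prod>x\<in>U. b x) * kernel_power K (offdiag b) r k l)
    \<le> real (card (signs D)) * matching_weight w (2 * r) (card U)"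
  using assms(4,5)
proof (induction r arbitrary: k U)
  case 0
  have "finite U" using 0 finite_D finite_subset by blast
  then show ?case
    using sum_signs_prod [OF finite_D, of U] 0 by (auto simp: sum_distrib_right [symmetric])
next
  case (Suc r)
  let ?c = "real (card (signs D))" and ?g = "matching_weight w (2 * r)" and ?u = "card U"
  have finU: "finite U" using Suc.prems finite_D finite_subset by blast
  have g: "?g u \<ge> 0" for u by (rule matching_weight_nonneg [OF w(1)])
  \<comment> \<open>The term \<open>x = k\<close> vanishes, and two toggles absorb the two new signs
    into the product over \<open>U\<close>, so that the induction hypothesis applies to the new
    set.\<close>
  have "(\<Prod>x\<in>U. b x) * kernel_power K (offdiag b) (Suc r) k l =
      (\<Sum>x\<in>K - {k}. \<Sum>i\<in>I. (\<Prod>y\<in>toggle (\<phi> x i) (toggle (\<phi> k i) U). b y)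
        * kernel_power K (offdiag b) r x l)" if b: "b \<in> signs D" for b
  proof -
    have "(\<Prod>x\<in>U. b x) * kernel_power K (offdiag b) (Suc r) k l
        = (\<Sum>x\<in>K - {k}. (\<Prod>x\<in>U. b x) * (offdiag b k x * kernel_power K (offdiag b) r x l))"
      using finite_K Suc.prems
      by (simp add: sum_distrib_left sum.remove [of K k] offdiag_def)
    also have "\<dots> = (\<Sum>x\<in>K - {k}. \<Sum>i\<in>I. (\<Prod>x\<in>U. b x) * b (\<phi> k i) * b (\<phi> x i)
        * kernel_power K (offdiag b) r x l)"
      by (intro sum.cong refl)
        (auto simp: offdiag_def sum_distrib_left sum_distrib_right mult.assoc)
    also have "\<dots> = (\<Sum>x\<in>K - {k}. \<Sum>i\<in>I. (\<Prod>y\<in>toggle (\<phi> x i) (toggle (\<phi> k i) U). b y)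
        * kernel_power K (offdiag b) r x l)"
    proof (intro sum.cong refl arg_cong2 [where f = "(*)"])
      fix x i assume xi: "x \<in> K - {k}" "i \<in> I"
      have "finite (toggle (\<phi> k i) U)" using finU by (simp add: toggle_def)
      then show "(\<Prod>x\<in>U. b x) * b (\<phi> k i) * b (\<phi> x i)
          = (\<Prod>y\<in>toggle (\<phi> x i) (toggle (\<phi> k i) U). b y)"
        using xi Suc.prems finU by (simp add: sign_mult_prod [OF b] range)
    qed
    finally show ?thesis .
  qed
  then have "(\<Sum>b\<in>signs D. (\<Prod>x\<in>U. b x) * kernel_power K (offdiag b) (Suc r) k l)
      = (\<Sum>b\<in>signs D. \<Sum>x\<in>K - {k}. \<Sum>i\<in>I. (\<Prod>y\<in>toggle (\<phi> x i) (toggle (\<phi> k i) U). b y)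
        * kernel_power K (offdiag b) r x l)"
    by (intro sum.cong refl)
  also have "\<dots> = (\<Sum>x\<in>K - {k}. \<Sum>i\<in>I. \<Sum>b\<in>signs D. (\<Prod>y\<in>toggle (\<phi> x i) (toggle (\<phi> k i) U). b y)
        * kernel_power K (offdiag b) r x l)"
    by (subst sum.swap, intro sum.cong refl, rule sum.swap)
  also have "\<dots> \<le> (\<Sum>x\<in>K - {k}. \<Sum>i\<in>I. ?c * ?g (card (toggle (\<phi> x i) (toggle (\<phi> k i) U))))"
    using Suc.prems by (intro sum_mono Suc.IH toggle_subset range) auto
  also have "\<dots> = ?c * (\<Sum>x\<in>K - {k}. \<Sum>i\<in>I. ?g (card (toggle (\<phi> x i) (toggle (\<phi> k i) U))))"
    by (simp add: sum_distrib_left)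
  also have "\<dots> \<le> ?c * (real (card K) * real (card I) * ?g (?u + 2)
      + 2 * real (card K) * real ?u * ?g ?u + real ?u * real (?u - 1) * ?g (?u - 2))"
    by (intro mult_left_mono sum_over_steps_le Suc.prems finU g) auto
  \<comment> \<open>The target is two recursion steps of \<open>matching_weight\<close>: with
    \<open>u = card U\<close>, opening then closing gives \<open>w * (u + 1)\<close>, closing then
    opening \<open>u * w\<close>. Here \<open>card K \<le> w\<close> enters.\<close>
  also have "\<dots> \<le> ?c * (w\<^sup>2 * ?g (?u + 2)
      + w * (2 * real ?u + 1) * ?g ?u + real ?u * real (?u - 1) * ?g (?u - 2))"
  proof (intro mult_left_mono add_mono mult_right_mono g)
    have "real (card K) * (2 * real ?u) \<le> w * (2 * real ?u + 1)"
      using w by (intro mult_mono) auto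
    then show "2 * real (card K) * real ?u \<le> w * (2 * real ?u + 1)" by simp
  qed (use w in auto)
  also have "w\<^sup>2 * ?g (?u + 2) + w * (2 * real ?u + 1) * ?g ?u + real ?u * real (?u - 1) * ?g (?u - 2)
      = matching_weight w (2 * Suc r) ?u"
    by (cases ?u) (simp_all add: algebra_simps power2_eq_square numeral_2_eq_2)
  finally show ?case .
qed

text \<open>Markov's inequality in counting form: a bad \<open>b\<close> has trace at least
  \<open>t ^ (2 * m)\<close>, while the traces summed over all signs are bounded by the walk count
  started from the empty set.\<close>

lemma card_large_eigenvalue_le:
  assumes w: "w \<ge> 0" "w\<^sup>2 = real (card K) * real (card I)" "real (card K) \<le> w" and t: "t \<ge> 0"
  shows "real (card {b \<in> signs D. \<exists>v \<mu>. (\<exists>k\<in>K. v k \<noteq> 0) \<and>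
      (\<forall>k\<in>K. (\<Sum>l\<in>K. offdiag b k l * v l) = \<mu> * v k) \<and> t < \<bar>\<mu>\<bar>}) * t ^ (2 * m)
    \<le> real (card (signs D)) * (real (card K) * (w * real (2 * m)) ^ (2 * m))"
proof -
  let ?tr = "\<lambda>b. \<Sum>k\<in>K. kernel_power K (offdiag b) (2 * m) k k"
  define B where "B = {b \<in> signs D. \<exists>v \<mu>. (\<exists>k\<in>K. v k \<noteq> 0) \<and>
      (\<forall>k\<in>K. (\<Sum>l\<in>K. offdiag b k l * v l) = \<mu> * v k) \<and> t < \<bar>\<mu>\<bar>}"
  have fin: "finite (signs D)" using finite_D by (intro finite_PiE) auto
  \<comment> \<open>A sum of squares by symmetry, so extending the sum from the bad \<open>b\<close>
    to all signs cannot decrease it.\<close>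
  have nonneg: "?tr b \<ge> 0" for b
  proof -
    have "?tr b = (\<Sum>k\<in>K. \<Sum>l\<in>K. (kernel_power K (offdiag b) m k l)\<^sup>2)"
      using kernel_power_add [OF finite_K, of _ "offdiag b" m m]
        kernel_power_commute [where H = "offdiag b" and r = m, OF finite_K offdiag_commute]
      by (auto simp: mult_2 power2_eq_square intro!: sum.cong)
    then show ?thesis by (simp add: sum_nonneg)
  qed
  have "real (card B) * t ^ (2 * m) = (\<Sum>b\<in>B. t ^ (2 * m))" by simp
  also have "\<dots> \<le> (\<Sum>b\<in>B. ?tr b)"
  proof (intro sum_mono)
    fix b assume "b \<in> B"
    then obtain v \<mu> k0 where v: "k0 \<in> K" "v k0 \<noteq> 0" "t < \<bar>\<mu>\<bar>"
      "\<And>k. k \<in> K \<Longrightarrow> (\<Sum>l\<in>K. offdiag b k l * v l) = \<mu> * v k"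
      unfolding B_def by blast
    have "t ^ (2 * m) \<le> \<bar>\<mu>\<bar> ^ (2 * m)" using v t by (intro power_mono) auto
    also have "\<dots> = \<mu> ^ (2 * m)" by (simp add: power_even_abs)
    also have "\<dots> \<le> ?tr b"
      by (rule eigenvalue_power_le_trace [OF finite_K offdiag_commute v(4) v(1,2)])
    finally show "t ^ (2 * m) \<le> ?tr b" .
  qed
  also have "\<dots> \<le> (\<Sum>b\<in>signs D. ?tr b)"
    by (rule sum_mono2 [OF fin]) (use nonneg in \<open>auto simp: B_def\<close>)
  also have "\<dots> = (\<Sum>k\<in>K. \<Sum>b\<in>signs D. (\<Prod>x\<in>{}. b x) * kernel_power K (offdiag b) (2 * m) k k)"
    by (subst sum.swap) simp
  \<comment> \<open>Each of the \<open>2 * m\<close> kernel factors reads two values, hence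
    \<open>4 * m\<close> points; the matching bound is then used with
    \<open>h = 2 * m\<close>.\<close>
  also have "\<dots> \<le> (\<Sum>k\<in>K. real (card (signs D)) * matching_weight w (2 * (2 * m)) (card ({} :: 'a set)))"
    by (intro sum_mono chaos_moment_le w) auto
  also have "\<dots> \<le> (\<Sum>k\<in>K. real (card (signs D)) * (w * real (2 * m)) ^ (2 * m))"
    using matching_weight_le [OF w(1), of "2 * m"] by (intro sum_mono mult_left_mono) auto
  finally show ?thesis by (simp add: B_def mult_ac)
qed

end

section \<open>Eigenvalues of the Gram matrix\<close>

lemma sum_nth_sorted_list_of_set:
  assumes "finite A"
  shows "(\<Sum>r<card A. f (sorted_list_of_set A ! r)) = (\<Sum>x\<in>A. f x)"
  using assms
  by (intro sum.reindex_bij_betw bij_betw_nth) (auto simp: lessThan_def)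

text \<open>Multiplying by \<open>card Om\<close> cancels the two scaling factors, and the
  eigenvector is carried along the increasing enumeration of \<open>La\<close> to a function on the
  index set, the form that the trace bound needs.\<close>

lemma eigenvalue_gram_sub_matrix_scaled:
  assumes fin: "finite Om" "finite La"
    and ev: "eigenvalue (gram (sub_matrix_scaled M Om La)) \<theta>"
  obtains v k0 where "k0 \<in> La" "v k0 \<noteq> 0"
    "\<And>k. k \<in> La \<Longrightarrow> (\<Sum>l\<in>La. (\<Sum>i\<in>Om. M i k * M i l) * v l) = real (card Om) * \<theta> * v k"
proof -
  let ?s = "card La" and ?n = "card Om"
  define xs where "xs = sorted_list_of_set Om"
  define ys where "ys = sorted_list_of_set La"
  define A where "A = sub_matrix_scaled M Om La"
  have A: "A \<in> carrier_mat ?n ?s" by (simp add: A_def sub_matrix_scaled_def)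
  have A_index: "A $$ (r, j) = (1 / sqrt (real ?n)) * M (xs ! r) (ys ! j)" if "r < ?n" "j < ?s" for r j
    using that by (simp add: A_def sub_matrix_scaled_def xs_def ys_def)
  have gram_carrier: "gram A \<in> carrier_mat ?s ?s" using A by (simp add: gram_def)
  obtain x where x: "x \<in> carrier_vec ?s" "x \<noteq> 0\<^sub>v ?s" "gram A *\<^sub>v x = \<theta> \<cdot>\<^sub>v x"
    using ev gram_carrier by (auto simp: eigenvalue_def eigenvector_def A_def)
  have bij: "bij_betw (nth ys) {..<?s} La"
    using fin by (intro bij_betw_nth) (auto simp: ys_def)
  define v where "v k = x $ (inv_into {..<?s} (nth ys) k)" for k
  have v_nth: "v (ys ! j) = x $ j" if "j < ?s" for j
    using that bij by (simp add: v_def bij_betw_inv_into_left)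
  have gram_index: "?n * gram A $$ (j, l) = (\<Sum>i\<in>Om. M i (ys ! j) * M i (ys ! l))"
    if "j < ?s" "l < ?s" for j l
  proof (cases "?n = 0")
    case True
    then show ?thesis using fin by simp
  next
    case False
    have "gram A $$ (j, l) = (\<Sum>r<?n. A $$ (r, j) * A $$ (r, l))"
      using that A by (simp add: gram_def scalar_prod_def lessThan_atLeast0)
    also have "\<dots> = (\<Sum>r<?n. (1 / ?n) * (M (xs ! r) (ys ! j) * M (xs ! r) (ys ! l)))"
      using that by (intro sum.cong refl) (simp add: A_index field_simps)
    also have "\<dots> = (1 / ?n) * (\<Sum>i\<in>Om. M i (ys ! j) * M i (ys ! l))"
      unfolding xs_def sum_distrib_left [symmetric]
      by (subst sum_nth_sorted_list_of_set [OF fin(1)]) simp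
    finally show ?thesis using False by simp
  qed
  have eq: "(\<Sum>l\<in>La. (\<Sum>i\<in>Om. M i k * M i l) * v l) = real ?n * \<theta> * v k" if k: "k \<in> La" for k
  proof -
    obtain j where j: "j < ?s" "k = ys ! j"
      using bij_betw_imp_surj_on [OF bij] k by blast
    have "(\<Sum>l\<in>La. (\<Sum>i\<in>Om. M i k * M i l) * v l)
        = (\<Sum>l<?s. (\<Sum>i\<in>Om. M i k * M i (ys ! l)) * v (ys ! l))"
      unfolding ys_def
      by (rule sum_nth_sorted_list_of_set [OF fin(2), symmetric])
    also have "\<dots> = (\<Sum>l<?s. real ?n * (gram A $$ (j, l) * x $ l))"
      using j by (intro sum.cong refl) (simp add: gram_index [symmetric] v_nth mult.assoc)
    also have "\<dots> = real ?n * (gram A *\<^sub>v x) $ j"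
      using gram_carrier x(1) j
      by (simp add: sum_distrib_left scalar_prod_def lessThan_atLeast0)
    also have "\<dots> = real ?n * \<theta> * v k"
      using x j by (simp add: v_nth)
    finally show ?thesis .
  qed
  obtain j where "j < ?s" "x $ j \<noteq> 0"
    using x(1,2) by (metis carrier_vecD eq_vecI index_zero_vec)
  then show thesis
    using that [of "ys ! j" v] eq v_nth bij by (auto simp: bij_betw_def)
qed

section \<open>Uniform sign arrays\<close>

text \<open>With \<open>L = ln (4 * s / \<epsilon>)\<close> and \<open>m\<close> its integer part,
  \<open>exp 1 \<le> pi\<close> and the constant \<open>4 * pi^2\<close> turn the hypothesis on
  \<open>n\<close> into \<open>exp 1 * w * 2 * m \<le> \<delta> * n\<close>. It remains that
  \<open>s * exp (- 2 * m) \<le> \<epsilon>\<close>.\<close>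

lemma moment_order_choice:
  fixes s n :: nat and \<epsilon> \<delta> :: real
  assumes "s > 0" "0 < \<epsilon>" "\<epsilon> < 1" "0 < \<delta>" "\<delta> < 1"
    and n: "real n \<ge> 4 * pi^2 * \<delta> powr (-2) * real s * (ln (4 * real s / \<epsilon>))^2"
  defines "w \<equiv> sqrt (real s * real n)"
  shows "s \<le> n"
    and "\<exists>m. real s * (w * real (2 * m)) ^ (2 * m) \<le> \<epsilon> * (\<delta> * real n) ^ (2 * m)"
proof -
  define L where "L = ln (4 * real s / \<epsilon>)"
  have pi3: "3 \<le> pi"
    using sin_x_le_x [of "pi / 6"] pi_gt_zero by (simp add: sin_30)
  have arg: "4 * real s / \<epsilon> > 3"
  proof -
    have "3 * \<epsilon> < 4 * real s" using assms by (simp add: order_less_le_trans [of _ 3])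
    then show ?thesis using assms by (simp add: field_simps)
  qed
  have "exp 1 \<le> 4 * real s / \<epsilon>" using exp_le arg by linarith
  then have L1: "L \<ge> 1"
    unfolding L_def using arg by (subst ln_ge_iff) auto
  have expL: "exp L = 4 * real s / \<epsilon>" using arg by (simp add: L_def)
  have nL: "\<delta>\<^sup>2 * real n \<ge> 4 * pi\<^sup>2 * real s * L\<^sup>2"
  proof -
    have "\<delta>\<^sup>2 * (4 * pi\<^sup>2 * \<delta> powr (-2) * real s * L\<^sup>2) \<le> \<delta>\<^sup>2 * real n"
      using n unfolding L_def by (intro mult_left_mono) auto
    moreover have "\<delta> powr (-2) = 1 / \<delta>\<^sup>2" using \<open>0 < \<delta>\<close> by (simp add: powr_minus_divide)
    ultimately show ?thesis using \<open>0 < \<delta>\<close> by simp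
  qed
  have piL: "2 * pi * L \<ge> 1" using pi3 L1 mult_mono [of 1 "2 * pi" 1 L] by simp
  show "s \<le> n"
  proof -
    have "1 * real s \<le> (2 * pi * L)\<^sup>2 * real s"
      using piL by (intro mult_right_mono) (auto simp: one_le_power)
    also have "\<dots> \<le> \<delta>\<^sup>2 * real n" using nL by (simp add: power_mult_distrib algebra_simps)
    also have "\<dots> \<le> 1 * real n"
      using assms by (intro mult_right_mono) (auto simp: power_le_one)
    finally show ?thesis by simp
  qed
  have w0: "w \<ge> 0" by (simp add: w_def)
  have key: "2 * pi * L * w \<le> \<delta> * real n"
  proof (rule power2_le_imp_le)
    have "(2 * pi * L * w)\<^sup>2 = (4 * pi\<^sup>2 * real s * L\<^sup>2) * real n"
      by (simp add: w_def power_mult_distrib)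
    also have "\<dots> \<le> (\<delta>\<^sup>2 * real n) * real n"
      using nL by (intro mult_right_mono) auto
    finally show "(2 * pi * L * w)\<^sup>2 \<le> (\<delta> * real n)\<^sup>2"
      by (simp add: power_mult_distrib power2_eq_square algebra_simps)
  qed (use assms in auto)
  define m where "m = nat \<lfloor>L\<rfloor>"
  have m: "real m \<le> L" "L - 1 \<le> real m" using L1 by (auto simp: m_def) 
  have base: "exp 1 * (w * real (2 * m)) \<le> \<delta> * real n"
  proof -
    have "exp 1 * (w * real (2 * m)) \<le> pi * (w * (2 * L))"
      using exp_le pi3 m w0 by (intro mult_mono) (auto intro: order_trans)
    also have "\<dots> \<le> \<delta> * real n" using key by (simp add: algebra_simps)
    finally show ?thesis .
  qed
  \<comment> \<open>Rounding \<open>L\<close> down costs at most one, and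
    \<open>exp 1 \<le> 3\<close> turns the loss \<open>(exp 1)^2\<close> into the factor
    \<open>9\<close>, which is absorbed by the \<open>16\<close> in \<open>16 * s^2\<close>.\<close>
  have "real s * 9 \<le> \<epsilon> * exp (real (2 * m)) * 9"
  proof -
    have "16 * (real s)\<^sup>2 = (\<epsilon> * exp L)\<^sup>2"
      using assms by (simp add: expL power_mult_distrib)
    also have "\<dots> = \<epsilon>\<^sup>2 * (exp (2 * (L - 1)) * (exp 1)\<^sup>2)"
      by (simp add: power_mult_distrib exp_double [symmetric] exp_add [symmetric])
    also have "\<dots> \<le> \<epsilon>\<^sup>2 * (exp (real (2 * m)) * 3\<^sup>2)"
      using exp_le m by (intro mult_left_mono mult_mono power_mono) auto
    also have "\<dots> \<le> \<epsilon> * (exp (real (2 * m)) * 3\<^sup>2)"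
      using assms by (intro mult_right_mono) (auto simp: power2_eq_square)
    finally have "16 * (real s)\<^sup>2 \<le> \<epsilon> * exp (real (2 * m)) * 9" by simp
    moreover have "real s \<le> (real s)\<^sup>2"
      using assms by (simp add: power2_eq_square)
    ultimately show ?thesis by linarith
  qed
  then have "real s * (w * real (2 * m)) ^ (2 * m)
      \<le> \<epsilon> * exp (real (2 * m)) * (w * real (2 * m)) ^ (2 * m)"
    using w0 by (intro mult_right_mono) auto
  also have "\<dots> = \<epsilon> * (exp 1 * (w * real (2 * m))) ^ (2 * m)"
    by (simp add: power_mult_distrib exp_of_nat_mult [symmetric])
  also have "\<dots> \<le> \<epsilon> * (\<delta> * real n) ^ (2 * m)"
    using assms w0 base by (intro mult_left_mono power_mono) auto
  finally show "\<exists>m. real s * (w * real (2 * m)) ^ (2 * m) \<le> \<epsilon> * (\<delta> * real n) ^ (2 * m)"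
    by blast
qed

lemma (in latin_array) prob_eigenvalue_deviation_le:
  assumes "K \<noteq> {}" "0 < \<epsilon>" "\<epsilon> < 1" "0 < \<delta>" "\<delta> < 1"
    and n: "real (card I) \<ge>
      4 * pi^2 * \<delta> powr (-2) * real (card K) * (ln (4 * real (card K) / \<epsilon>))^2"
  shows "measure_pmf.prob (pmf_of_set (signs D)) {b. \<exists>v \<mu>. (\<exists>k\<in>K. v k \<noteq> 0) \<and>
      (\<forall>k\<in>K. (\<Sum>l\<in>K. offdiag b k l * v l) = \<mu> * v k) \<and> \<delta> * real (card I) < \<bar>\<mu>\<bar>} \<le> \<epsilon>"
proof -
  let ?s = "card K" and ?n = "card I" and ?c = "real (card (signs D))"
  define w where "w = sqrt (real ?s * real ?n)"
  define B where "B = {b. \<exists>v \<mu>. (\<exists>k\<in>K. v k \<noteq> 0) \<and>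
      (\<forall>k\<in>K. (\<Sum>l\<in>K. offdiag b k l * v l) = \<mu> * v k) \<and> \<delta> * real ?n < \<bar>\<mu>\<bar>}"
  have s: "?s > 0" using assms(1) finite_K by (simp add: card_gt_0_iff)
  have sn: "?s \<le> ?n" by (rule moment_order_choice(1) [OF s assms(2-5) n])
  obtain m where m: "real ?s * (w * real (2 * m)) ^ (2 * m) \<le> \<epsilon> * (\<delta> * real ?n) ^ (2 * m)"
    using moment_order_choice(2) [OF s assms(2-5) n] unfolding w_def by blast
  have fin: "finite (signs D)" "signs D \<noteq> {}"
    using finite_D by (auto intro!: finite_PiE simp: PiE_eq_empty_iff)
  have "real ?s \<le> w"
    unfolding w_def using sn by (intro real_le_rsqrt) (simp add: power2_eq_square mult_left_mono)
  then have "real (card (signs D \<inter> B)) * (\<delta> * real ?n) ^ (2 * m)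
      \<le> ?c * (real ?s * (w * real (2 * m)) ^ (2 * m))"
    using card_large_eigenvalue_le [of w "\<delta> * real ?n" m] assms
    by (simp add: w_def B_def Int_def)
  also have "\<dots> \<le> ?c * (\<epsilon> * (\<delta> * real ?n) ^ (2 * m))"
    using m by (intro mult_left_mono) auto
  finally have "real (card (signs D \<inter> B)) * (\<delta> * real ?n) ^ (2 * m)
      \<le> (?c * \<epsilon>) * (\<delta> * real ?n) ^ (2 * m)" by (simp add: mult.assoc)
  moreover have "(\<delta> * real ?n) ^ (2 * m) > 0"
    using s sn assms by (intro zero_less_power mult_pos_pos) auto
  ultimately have "real (card (signs D \<inter> B)) \<le> ?c * \<epsilon>"
    by (rule mult_right_le_imp_le)
  moreover have "?c > 0" using fin by (simp add: card_gt_0_iff)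
  ultimately have "measure_pmf.prob (pmf_of_set (signs D)) B \<le> \<epsilon>"
    using fin by (simp add: measure_pmf_of_set field_simps)
  then show ?thesis by (simp add: B_def)
qed

text \<open>An eigenvalue \<open>\<theta>\<close> of the Gram matrix yields the eigenvalue
  \<open>card \<Omega> * (\<theta> - 1)\<close> of \<open>offdiag b\<close>, so outside the bad
  event \<open>\<theta>\<close> lies within \<open>\<delta>\<close> of \<open>1\<close>.\<close>

lemma prob_eig_in_range:
  fixes \<Omega> \<Lambda> :: "nat set" and \<phi> :: "nat \<Rightarrow> nat \<Rightarrow> 'a"
  assumes "latin_array \<phi> \<Lambda> \<Omega> D"
    and "0 < \<epsilon>" "\<epsilon> < 1" "0 < \<delta>" "\<delta> < 1"
    and n: "real (card \<Omega>) \<ge>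
      4 * pi^2 * \<delta> powr (-2) * real (card \<Lambda>) * (ln (4 * real (card \<Lambda>) / \<epsilon>))^2"
  shows "measure_pmf.prob (pmf_of_set (signs D))
    {b. eig_in_range (gram (sub_matrix_scaled (\<lambda>i k. b (\<phi> k i)) \<Omega> \<Lambda>)) \<delta>} \<ge> 1 - \<epsilon>"
proof -
  interpret latin_array \<phi> \<Lambda> \<Omega> D by fact
  let ?P = "measure_pmf.prob (pmf_of_set (signs D))"
  let ?n = "card \<Omega>"
  define good where "good = {b. eig_in_range (gram (sub_matrix_scaled (\<lambda>i k. b (\<phi> k i)) \<Omega> \<Lambda>)) \<delta>}"
  define B where "B = {b. \<exists>v \<mu>. (\<exists>k\<in>\<Lambda>. v k \<noteq> 0) \<and>
      (\<forall>k\<in>\<Lambda>. (\<Sum>l\<in>\<Lambda>. offdiag b k l * v l) = \<mu> * v k) \<and> \<delta> * real ?n < \<bar>\<mu>\<bar>}"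
  have fin: "finite (signs D)" "signs D \<noteq> {}"
    using finite_D by (auto intro!: finite_PiE simp: PiE_eq_empty_iff)
  have "?P B \<le> \<epsilon>"
  \<comment> \<open>On an empty \<open>\<Lambda>\<close> no \<open>v\<close> is nonzero, so
    \<open>B\<close> is empty; the choice of the moment order assumes
    \<open>card \<Lambda> > 0\<close>.\<close>
  proof (cases "\<Lambda> = {}")
    case True
    then show ?thesis using assms by (simp add: B_def)
  next
    case False
    then show ?thesis
      unfolding B_def by (rule prob_eigenvalue_deviation_le) (use assms in auto)
  qed
  have "signs D - B \<subseteq> good"
  proof
    fix b assume b: "b \<in> signs D - B"
    show "b \<in> good"
      unfolding good_def eig_in_range_def
    proof (intro CollectI allI impI)
      fix \<theta> assume "eigenvalue (gram (sub_matrix_scaled (\<lambda>i k. b (\<phi> k i)) \<Omega> \<Lambda>)) \<theta>"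
      then obtain v k0 where v: "k0 \<in> \<Lambda>" "v k0 \<noteq> 0" "\<And>k. k \<in> \<Lambda> \<Longrightarrow>
          (\<Sum>l\<in>\<Lambda>. (\<Sum>i\<in>\<Omega>. b (\<phi> k i) * b (\<phi> l i)) * v l) = real ?n * \<theta> * v k"
        by (rule eigenvalue_gram_sub_matrix_scaled [OF finite_I finite_K]) (rule that)
      have s: "card \<Lambda> > 0" using v(1) finite_K by (auto simp: card_gt_0_iff)
      have n_pos: "?n > 0"
        using moment_order_choice(1) [OF s assms(2-5) n] s by simp
      have "(\<Sum>l\<in>\<Lambda>. offdiag b k l * v l) = real ?n * (\<theta> - 1) * v k" if k: "k \<in> \<Lambda>" for k
      proof -
        have "b (\<phi> k i) * b (\<phi> k i) = 1" if "i \<in> \<Omega>" for i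
          using b range [OF k that] by (auto simp: PiE_iff)
        then have "(\<Sum>i\<in>\<Omega>. b (\<phi> k i) * b (\<phi> k i)) = real ?n" by simp
        then have "real ?n * \<theta> * v k = real ?n * v k + (\<Sum>l\<in>\<Lambda> - {k}. offdiag b k l * v l)"
          using v(3) [OF k] finite_K k by (simp add: sum.remove [of \<Lambda> k] offdiag_def)
        moreover have "(\<Sum>l\<in>\<Lambda>. offdiag b k l * v l) = (\<Sum>l\<in>\<Lambda> - {k}. offdiag b k l * v l)"
          using finite_K k by (simp add: sum.remove [of \<Lambda> k] offdiag_def)
        ultimately show ?thesis by (simp add: algebra_simps)
      qed
      then have "\<not> \<delta> * real ?n < \<bar>real ?n * (\<theta> - 1)\<bar>"
        using b v(1,2) unfolding B_def by blast
      then have "\<bar>\<theta> - 1\<bar> * real ?n \<le> \<delta> * real ?n"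
        by (simp add: abs_mult mult.commute)
      then have "\<bar>\<theta> - 1\<bar> \<le> \<delta>"
        using n_pos by simp
      then show "1 - \<delta> \<le> \<theta> \<and> \<theta> \<le> 1 + \<delta>" by linarith
    qed
  qed
  \<comment> \<open>The inclusion was shown on the support of the distribution, hence monotonicity
    almost everywhere.\<close>
  then have "?P (UNIV - B) \<le> ?P good"
    using fin by (intro measure_pmf.finite_measure_mono_AE) (auto simp: AE_measure_pmf_iff)
  moreover have "?P (UNIV - B) = 1 - ?P B"
    using measure_pmf.prob_compl [of B "pmf_of_set (signs D)"] by simp
  ultimately show ?thesis
    using \<open>?P B \<le> \<epsilon>\<close> by (simp add: good_def)
qed

section \<open>Index arrays of circulant and Toeplitz matrices\<close>

lemma latin_array_circulant:
  assumes "\<Omega> \<subseteq> {1..N}" "\<Lambda> \<subseteq> {1..N}"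
  shows "latin_array (\<lambda>k i. nat ((int k - int i) mod int N)) \<Lambda> \<Omega> {0..<N}"
proof
  \<comment> \<open>Two elements of \<open>{1..N}\<close> differ by less than \<open>N\<close>, so
    congruence modulo \<open>N\<close> forces equality; both injectivity claims reduce to
    this.\<close>
  have eq: "x = y" if "x \<in> {1..N}" "y \<in> {1..N}" "int N dvd int x - int y" for x y
  proof (rule ccontr)
    assume "x \<noteq> y"
    then have "\<bar>int N\<bar> \<le> \<bar>int x - int y\<bar>" using that(3) by (intro dvd_imp_le_int) auto
    then show False using that(1,2) by auto
  qed
  have nat_eq: "int N dvd x - y" if "nat (x mod int N) = nat (y mod int N)" "N > 0" for x y :: int
    using that by (simp add: nat_eq_iff mod_eq_dvd_iff)
  show "finite \<Lambda>" "finite \<Omega>" using assms finite_subset by auto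
  show "nat ((int k - int i) mod int N) \<in> {0..<N}" if "k \<in> \<Lambda>" "i \<in> \<Omega>" for k i
    using that assms by (auto simp: nat_less_iff)
  show "inj_on (\<lambda>i. nat ((int k - int i) mod int N)) \<Omega>" for k
  proof (rule inj_onI)
    fix x y assume xy: "x \<in> \<Omega>" "y \<in> \<Omega>"
      and "nat ((int k - int x) mod int N) = nat ((int k - int y) mod int N)"
    then have "int N dvd int k - int x - (int k - int y)" using assms by (intro nat_eq) auto
    then show "x = y" using xy assms(1) eq [of y x] by (auto simp: subset_iff)
  qed
  show "inj_on (\<lambda>k. nat ((int k - int i) mod int N)) \<Lambda>" for i
  proof (rule inj_onI)
    fix x y assume xy: "x \<in> \<Lambda>" "y \<in> \<Lambda>"
      and "nat ((int x - int i) mod int N) = nat ((int y - int i) mod int N)"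
    then have "int N dvd int x - int i - (int y - int i)" using assms by (intro nat_eq) auto
    then show "x = y" using xy assms(2) eq [of x y] by (auto simp: subset_iff)
  qed
qed auto

lemma latin_array_toeplitz:
  assumes "\<Omega> \<subseteq> {1..N}" "\<Lambda> \<subseteq> {1..N}"
  shows "latin_array (\<lambda>k i. int k - int i) \<Lambda> \<Omega> {- (int N - 1)..int N - 1}"
proof
  show "finite \<Lambda>" "finite \<Omega>" using assms finite_subset by auto
  show "int k - int i \<in> {- (int N - 1)..int N - 1}" if "k \<in> \<Lambda>" "i \<in> \<Omega>" for k i
  proof -
    have "k \<in> {1..N}" "i \<in> {1..N}" using that assms by auto
    then show ?thesis by auto
  qed
qed (auto simp: inj_on_def)

theorem theorem5:
  fixes N n s :: nat and \<Omega> \<Lambda> :: "nat set" and \<epsilon> \<delta> :: real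
  assumes "\<Omega> \<subseteq> {1..N}" and "\<Lambda> \<subseteq> {1..N}"
    and "card \<Omega> = n" and "card \<Lambda> = s"
    and "0 < \<epsilon>" and "\<epsilon> < 1" and "0 < \<delta>" and "\<delta> < 1"
    and "real n \<ge> 4 * pi^2 * \<delta> powr (-2) * real s * (ln (4 * real s / \<epsilon>))^2"
  shows "(measure_pmf.prob (bern_b N)
           {b. eig_in_range (gram (sub_matrix_scaled (circulant_entry N b) \<Omega> \<Lambda>)) \<delta>}
           \<ge> 1 - \<epsilon>) \<and>
         (measure_pmf.prob (bern_c N)
           {c. eig_in_range (gram (sub_matrix_scaled (toeplitz_entry c) \<Omega> \<Lambda>)) \<delta>}
           \<ge> 1 - \<epsilon>)"
proof -
  have "circulant_entry N b = (\<lambda>i k. b (nat ((int k - int i) mod int N)))" for b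
    by (simp add: circulant_entry_def fun_eq_iff)
  moreover have "toeplitz_entry c = (\<lambda>i k. c (int k - int i))" for c
    by (simp add: toeplitz_entry_def fun_eq_iff)
  ultimately show ?thesis
    using prob_eig_in_range [OF latin_array_circulant [OF assms(1,2)] assms(5-8)]
      prob_eig_in_range [OF latin_array_toeplitz [OF assms(1,2)] assms(5-8)]
      assms(3,4,9)
    by (simp add: bern_b_def bern_c_def)
qed

end
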